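(* Let $s\ge1$ and let $d_1,\dots,d_s\ge1$ be integers. Suppose that $$y=\sum_{i=1}^s2^{d_1+\cdots+d_i}\qquad\text{or}\qquad y=1+\sum_{i=1}^s2^{d_1+\cdots+d_i}.$$ Then $\text{c-Ulam}[y]$ (restricted to its periodic block $B_{d_1+\cdots+d_s+1}$) has both $i_{d_1,d_2,\dots,d_s}$ hierarchical structure and $e_{d_1,d_2,\dots,d_s}$ hierarchical structure.
   Context: $\mathbb{N}=\{0,1,2,\dots\}$; $n\bmod m$ denotes the residue in $\{0,\dots,m-1\}$. Ulam words are binary words defined recursively: $\mathcal{U}(1)=\{0,1\}$, and for $n>1$, $\mathcal{U}(n)$ is the set of all words of length $n$ over $\{0,1\}$ that are expressible uniquely as a concatenation $uv$ of two distinct words $u\in\mathcal{U}(i)$, $v\in\mathcal{U}(j)$ with $i,j<n$ (exactly one ordered pair $(u,v)$, $u\ne v$). A word is Ulam if it belongs to $\bigcup_{n\ge1}\mathcal{U}(n)$. $\text{c-Ulam}[y]:\mathbb{N}^2\to\{0,1,2\}$: $\text{c-Ulam}[y](x,z)$ is the minimum of $2$ and the number of representations of $0^x10^y10^z$ as a concatenation of two (not necessarily distinct) Ulam words with exactly one $1$ each, i.e. the number of integers $a$, $0\le a\le y$, such that both $0^x10^a$ and $0^{y-a}10^z$ are Ulam. $B_d=\{0,1,\dots,2^d-1\}^2$, $T=\{0,1,2\}$. For $m,n\in T$: $m\,\widehat{+}\,n=\min(m+n,2)$, $m\,\widehat{\cdot}\,n=\min(mn,2)$; these are applied pointwise to labelings.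 Basic labelings $E_1[d],E_2[d],O_1[d],O_2[d]:B_d\to T$ ($d\ge1$): - If $x+z\ge2^d-1$, $E_1[d](x,z)=0$. Otherwise let $e$ be the largest $0\le e<d$ with $(x\bmod 2^{e+1})<2^e$ and $(z\bmod 2^{e+1})<2^e$; $E_1[d](x,z)=2$ if $(x\bmod 2^e)+(z\bmod 2^e)<2^e-1$, and $1$ otherwise. - $E_2[d]\equiv1$. - If $x+z\ge2^d-2$, $O_1[d](x,z)=0$. Otherwise, if $x+z$ is even, $O_1[d](x,z)=0$ for $x$ odd and $2$ for $x$ even; if $x+z<2^d-2$ is odd, with $e$ as for $E_1[d]$, $O_1[d](x,z)=2$ if $(x\bmod 2^e)+(z\bmod 2^e)<2^e-1$, and $1$ otherwise. - If $x+z$ is even, $O_2[d](x,z)=0$ for $x$ odd and $2$ for $x$ even; if $x+z$ is odd, $O_2[d](x,z)=1$. Internal hierarchy. For $a,b\in T$ let $I_d^e(a,b)=a\,\widehat{\cdot}\,E_1[d]\,\widehat{+}\,b\,\widehat{\cdot}\,E_2[d]$ and $I_d^o(a,b)=a\,\widehat{\cdot}\,O_1[d]\,\widehat{+}\,b\,\widehat{\cdot}\,O_2[d]$, which are labelings $B_d\to T$. A labeling $\mathcal{L}:B_{d_1+\cdots+d_s+1}\to T$ has $i_{d_1,\dots,d_s}$ hierarchical structure if there exist labelings $c_j^e,c_j^o:B_{d_j+d_{j+1}+\cdots+d_s+1}\to T$ for $j=1,\dots,s$, and $c_{s+1}^e,c_{s+1}^o:B_1\to T$, such that for all $j=1,\dots,s$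 and all $(x,z)\in B_{d_j+\cdots+d_s+1}$ $$c_j^e(x,z)=I_{d_j}^e\bigl(c_{j+1}^e(x',z'),c_{j+1}^o(x',z')\bigr)(x'',z''),\qquad c_j^o(x,z)=I_{d_j}^o\bigl(c_{j+1}^e(x',z'),c_{j+1}^o(x',z')\bigr)(x'',z''),$$ and $\mathcal{L}=c_1^e$ or $\mathcal{L}=c_1^o$. Here $x'=\lfloor x/2^{d_j}\rfloor$, $z'=\lfloor z/2^{d_j}\rfloor$ (the first $d_{j+1}+\cdots+d_s+1$ binary digits, counting leading $0$'s) and $x''=x\bmod2^{d_j}$, $z''=z\bmod2^{d_j}$ (the last $d_j$ digits). External hierarchy. The empty label is $t=0$ and the full label is $f=2$. Let $$L_{d,0}^e=2\,\widehat{\cdot}\,E_2[d],\quad L_{d,1}^e=L_{d,2}^e=E_1[d]\,\widehat{+}\,E_2[d],\quad L_{d,3}^e=E_1[d],$$ $$L_{d,0}^o=2\,\widehat{\cdot}\,O_2[d],\quad L_{d,1}^o=L_{d,2}^o=O_1[d]\,\widehat{+}\,O_2[d],\quad L_{d,3}^o=O_1[d],$$ and let $I:T\times T\to\{0,1,2,3,4,5\}$ be given by $I(0,0)=4$, $I(1,0)=3$, $I(2,0)=5$, $I(0,1)=I(1,1)=I(2,1)=2$, $I(0,2)=I(1,2)=I(2,2)=0$. A labeling $\mathcal{L}:B_{d_1+\cdots+d_s+1}\to T$ has $e_{d_1,\dots,d_s}$ hierarchical structure if there exist labelings $c_j^i:B_{d_1+\cdots+d_j}\to T$ for $1\le j\le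 s$ and $i\in\{0,1,2,3,4,5\}$ such that: for all $j$, $c_j^4(x,z)=t$, and $c_j^5(x,z)=t$ if $c_j^3(x,z)=t$ while $c_j^5(x,z)=f$ if $c_j^3(x,z)\ne t$; for $i<4$ and $2\le j\le s$, $$c_j^i(x,z)=c_{j-1}^{I\left(L_{d_j,i}^e(x'',z''),\,L_{d_j,i}^o(x'',z'')\right)}(x',z'),$$ where $x',z'$ are the trailing $d_1+\cdots+d_{j-1}$ binary digits of $x,z$ (residues modulo $2^{d_1+\cdots+d_{j-1}}$) and $x'',z''$ are the first $d_j$ digits (counting leading $0$'s; i.e. $x''=\lfloor x/2^{d_1+\cdots+d_{j-1}}\rfloor$, and similarly $z''$); and, with $D=d_1+\cdots+d_s$, for all $(x,z)\in B_D$, $$c_s^0(x,z)=\mathcal{L}(x,z),\ c_s^1(x,z)=\mathcal{L}(2^D+x,z),\ c_s^2(x,z)=\mathcal{L}(x,2^D+z),\ c_s^3(x,z)=\mathcal{L}(2^D+x,2^D+z).$$ *)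

theory Defs
  imports Main "HOL-Library.FuncSet"
begin

section \<open>Ulam words\<close>

text \<open>Binary words are boolean lists, \<^term>\<open>False\<close> being the letter 0 and \<^term>\<open>True\<close> the
  letter 1. There are no Ulam words of length 0.\<close>

fun ulam_words :: "nat \<Rightarrow> bool list set" where
  "ulam_words n =
    (if n = 0 then {}
     else if n = 1 then {[False], [True]}
     else {w. length w = n \<and>
              (\<exists>!(u, v). u \<noteq> v \<and> u @ v = w \<and>
                 (\<exists>i\<in>{1..<n}. u \<in> ulam_words i) \<and> (\<exists>j\<in>{1..<n}. v \<in> ulam_words j))})"

declare ulam_words.simps [simp del]

definition ulam :: "bool list \<Rightarrow> bool" where
  "ulam w \<longleftrightarrow> w \<in> (\<Union>n\<in>{1..}. ulam_words n)"

definition c_ulam :: "nat \<Rightarrow> nat \<times> nat \<Rightarrow> nat" where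
  "c_ulam y = (\<lambda>(x, z). min 2 (card {(u, v).
      ulam u \<and> ulam v \<and> count_list u True = 1 \<and> count_list v True = 1 \<and>
      u @ v = replicate x False @ [True] @ replicate y False @ [True] @ replicate z False}))"

section \<open>Labelings\<close>

definition block :: "nat \<Rightarrow> (nat \<times> nat) set" where
  "block d = {0..<2 ^ d} \<times> {0..<2 ^ d}"

definition labels :: "nat set" where
  "labels = {0, 1, 2}"

definition tadd :: "nat \<Rightarrow> nat \<Rightarrow> nat"  (infixl \<open>\<boxplus>\<close> 65) where
  "m \<boxplus> n = min (m + n) 2"

definition tmul :: "nat \<Rightarrow> nat \<Rightarrow> nat"  (infixl \<open>\<boxdot>\<close> 70) where
  "m \<boxdot> n = min (m * n) 2"

text \<open>The set below is nonempty whenever \<open>x + z < 2 ^ d - 1\<close>, the only case in which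
  \<open>top_gap\<close> is used.\<close>

definition top_gap :: "nat \<Rightarrow> nat \<Rightarrow> nat \<Rightarrow> nat" where
  "top_gap d x z = Max {e. e < d \<and> x mod 2 ^ (e + 1) < 2 ^ e \<and> z mod 2 ^ (e + 1) < 2 ^ e}"

definition gap_label :: "nat \<Rightarrow> nat \<Rightarrow> nat \<Rightarrow> nat" where
  "gap_label d x z =
    (let e = top_gap d x z in if x mod 2 ^ e + z mod 2 ^ e < 2 ^ e - 1 then 2 else 1)"

definition E1 :: "nat \<Rightarrow> nat \<times> nat \<Rightarrow> nat" where
  "E1 d = (\<lambda>(x, z). if x + z \<ge> 2 ^ d - 1 then 0 else gap_label d x z)"

definition E2 :: "nat \<Rightarrow> nat \<times> nat \<Rightarrow> nat" where
  "E2 d = (\<lambda>(x, z). 1)"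

definition O1 :: "nat \<Rightarrow> nat \<times> nat \<Rightarrow> nat" where
  "O1 d = (\<lambda>(x, z).
     if x + z \<ge> 2 ^ d - 2 then 0
     else if even (x + z) then (if odd x then 0 else 2)
     else gap_label d x z)"

definition O2 :: "nat \<Rightarrow> nat \<times> nat \<Rightarrow> nat" where
  "O2 d = (\<lambda>(x, z).
     if even (x + z) then (if odd x then 0 else 2) else 1)"

section \<open>Internal hierarchical structure\<close>

definition I_even :: "nat \<Rightarrow> nat \<Rightarrow> nat \<Rightarrow> nat \<times> nat \<Rightarrow> nat" where
  "I_even d a b = (\<lambda>p. a \<boxdot> E1 d p \<boxplus> b \<boxdot> E2 d p)"

definition I_odd :: "nat \<Rightarrow> nat \<Rightarrow> nat \<Rightarrow> nat \<times> nat \<Rightarrow> nat" where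
  "I_odd d a b = (\<lambda>p. a \<boxdot> O1 d p \<boxplus> b \<boxdot> O2 d p)"

text \<open>The sequence \<open>d\<^sub>1, \<dots>, d\<^sub>s\<close> is given by the values of a function \<open>d\<close> on \<open>{1..s}\<close>;
  its values elsewhere are never used. In particular \<open>block ((\<Sum>k=s+1..s. d k) + 1)\<close> is
  \<open>block 1\<close>.\<close>

definition internal_hierarchical ::
    "nat \<Rightarrow> (nat \<Rightarrow> nat) \<Rightarrow> (nat \<times> nat \<Rightarrow> nat) \<Rightarrow> bool" where
  "internal_hierarchical s d L \<longleftrightarrow>
     L \<in> block ((\<Sum>k=1..s. d k) + 1) \<rightarrow> labels \<and>
     (\<exists>ce co :: nat \<Rightarrow> nat \<times> nat \<Rightarrow> nat.
        (\<forall>j\<in>{1..s+1}. ce j \<in> block ((\<Sum>k=j..s. d k) + 1) \<rightarrow> labels \<and>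
                      co j \<in> block ((\<Sum>k=j..s. d k) + 1) \<rightarrow> labels) \<and>
        (\<forall>j\<in>{1..s}. \<forall>(x, z)\<in>block ((\<Sum>k=j..s. d k) + 1).
           let p' = (x div 2 ^ d j, z div 2 ^ d j);
               p'' = (x mod 2 ^ d j, z mod 2 ^ d j)
           in ce j (x, z) = I_even (d j) (ce (j + 1) p') (co (j + 1) p') p'' \<and>
              co j (x, z) = I_odd (d j) (ce (j + 1) p') (co (j + 1) p') p'') \<and>
        ((\<forall>p\<in>block ((\<Sum>k=1..s. d k) + 1). L p = ce 1 p) \<or>
         (\<forall>p\<in>block ((\<Sum>k=1..s. d k) + 1). L p = co 1 p)))"

section \<open>External hierarchical structure\<close>

definition empty_label :: nat where "empty_label = 0"

definition full_label :: nat where "full_label = 2"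

text \<open>Only the indices \<open>i = 0, 1, 2, 3\<close> are meaningful here.\<close>

definition L_even :: "nat \<Rightarrow> nat \<Rightarrow> nat \<times> nat \<Rightarrow> nat" where
  "L_even d i = (\<lambda>p.
     if i = 0 then 2 \<boxdot> E2 d p
     else if i = 1 \<or> i = 2 then E1 d p \<boxplus> E2 d p
     else E1 d p)"

definition L_odd :: "nat \<Rightarrow> nat \<Rightarrow> nat \<times> nat \<Rightarrow> nat" where
  "L_odd d i = (\<lambda>p.
     if i = 0 then 2 \<boxdot> O2 d p
     else if i = 1 \<or> i = 2 then O1 d p \<boxplus> O2 d p
     else O1 d p)"

text \<open>Only arguments in \<^const>\<open>labels\<close> are meaningful here.\<close>

definition I_index :: "nat \<Rightarrow> nat \<Rightarrow> nat" where
  "I_index a b =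
     (if b = 0 then (if a = 0 then 4 else if a = 1 then 3 else 5)
      else if b = 1 then 2
      else 0)"

text \<open>The labeling \<open>c\<^sub>j\<^sup>i\<close> is \<open>c j i\<close>.\<close>

definition external_hierarchical ::
    "nat \<Rightarrow> (nat \<Rightarrow> nat) \<Rightarrow> (nat \<times> nat \<Rightarrow> nat) \<Rightarrow> bool" where
  "external_hierarchical s d L \<longleftrightarrow>
     L \<in> block ((\<Sum>k=1..s. d k) + 1) \<rightarrow> labels \<and>
     (\<exists>c :: nat \<Rightarrow> nat \<Rightarrow> nat \<times> nat \<Rightarrow> nat.
        (\<forall>j\<in>{1..s}. \<forall>i\<in>{0..5}. c j i \<in> block (\<Sum>k=1..j. d k) \<rightarrow> labels) \<and>
        (\<forall>j\<in>{1..s}. \<forall>p\<in>block (\<Sum>k=1..j. d k).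
           c j 4 p = empty_label \<and>
           c j 5 p = (if c j 3 p = empty_label then empty_label else full_label)) \<and>
        (\<forall>j\<in>{2..s}. \<forall>i<4. \<forall>(x, z)\<in>block (\<Sum>k=1..j. d k).
           let D' = (\<Sum>k=1..j-1. d k);
               p' = (x mod 2 ^ D', z mod 2 ^ D');
               p'' = (x div 2 ^ D', z div 2 ^ D')
           in c j i (x, z) = c (j - 1) (I_index (L_even (d j) i p'') (L_odd (d j) i p'')) p') \<and>
        (let D = (\<Sum>k=1..s. d k) in
           \<forall>(x, z)\<in>block D.
             c s 0 (x, z) = L (x, z) \<and>
             c s 1 (x, z) = L (2 ^ D + x, z) \<and>
             c s 2 (x, z) = L (x, 2 ^ D + z) \<and>
             c s 3 (x, z) = L (2 ^ D + x, 2 ^ D + z)))"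

end

theory Submission
  imports Defs
begin

text \<open>Prepending or appending the letter 0 gives Pascal's rule modulo 2, so \<open>0\<^sup>x 1 0\<^sup>a\<close> is Ulam iff
  \<open>x\<close> and \<open>a\<close> have disjoint binary expansions. Hence \<open>c_ulam y (x, z)\<close> counts, up to 2, the
  splittings \<open>y = a + b\<close> with \<open>a\<close> disjoint from \<open>x\<close> and \<open>b\<close> disjoint from \<open>z\<close>. Cutting all numbers
  at bit \<open>d\<close> turns this count into a sum of two products, one without and one with a carry into bit
  \<open>d\<close>. The factors of a block of \<open>d\<close> bits count, for \<open>r = 0, 1\<close>, the splittings of \<open>r\<close> and
  \<open>2\<^sup>d + r\<close> into numbers below \<open>2\<^sup>d\<close>, which are \<open>E2, O2\<close> and \<open>E1, O1\<close>; cutting off the lowest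
  block yields the internal hierarchy, cutting off the highest one the external hierarchy.\<close>

section \<open>Ulam words with a single letter 1\<close>

definition one_word :: "nat \<Rightarrow> nat \<Rightarrow> bool list" where
  "one_word x a = replicate x False @ True # replicate a False"

lemma replicate_True_eq_iff:
  "replicate x False @ True # us = replicate y False @ True # vs \<longleftrightarrow> x = y \<and> us = vs"
proof (induction x arbitrary: y)
  case 0
  then show ?case by (cases y) auto
next
  case (Suc x)
  then show ?case by (cases y) auto
qed

lemma one_word_inject: "one_word x a = one_word y b \<longleftrightarrow> x = y \<and> a = b"
  by (simp add: one_word_def replicate_True_eq_iff)

lemma Cons_False_eq_one_word: "False # v = one_word x a \<longleftrightarrow> (\<exists>x'. x = Suc x' \<and> v = one_word x' a)"
  by (cases x) (auto simp: one_word_def)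

lemma one_word_append_replicate: "one_word x a @ replicate n False = one_word x (a + n)"
  by (simp add: one_word_def replicate_add)

lemma count_True_0_iff: "count_list u True = 0 \<longleftrightarrow> u = replicate (length u) False"
  by (metis (full_types) count_list_0_iff in_set_replicate replicate_eqI)

lemma count_True_1_iff: "count_list u True = 1 \<longleftrightarrow> (\<exists>x a. u = one_word x a)"
proof
  assume *: "count_list u True = 1"
  then have "True \<in> set u" by (metis count_list_0_iff zero_neq_one)
  then obtain ys zs where u: "u = ys @ True # zs" by (meson split_list)
  with * have "count_list ys True = 0" "count_list zs True = 0" by auto
  then show "\<exists>x a. u = one_word x a"
    unfolding count_True_0_iff one_word_def u by metis
next
  assume "\<exists>x a. u = one_word x a"
  moreover have "count_list (replicate n False) True = 0" for n
    by (simp add: count_True_0_iff)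
  ultimately show "count_list u True = 1" by (auto simp: one_word_def)
qed

lemma length_ulam_words: "w \<in> ulam_words n \<Longrightarrow> length w = n"
  by (subst (asm) ulam_words.simps) (auto split: if_splits)

lemma ulam_iff_length: "ulam w \<longleftrightarrow> w \<in> ulam_words (length w)"
proof -
  have "ulam_words 0 = {}" by (subst ulam_words.simps) simp
  then have pos: "n \<ge> 1" if "w \<in> ulam_words n" for n using that by (metis empty_iff less_one not_le)
  show ?thesis
    unfolding ulam_def UN_iff Bex_def atLeast_iff using pos length_ulam_words by metis
qed

lemma not_ulam_Nil: "\<not> ulam []"
  unfolding ulam_def UN_iff Bex_def atLeast_iff using length_ulam_words by fastforce

lemma ulam_singleton: "ulam [b]"
  by (cases b; simp add: ulam_iff_length; subst ulam_words.simps) auto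

text \<open>The bounds on the factor lengths come for free: the empty word is not Ulam, and the two
  lengths add up to that of \<open>w\<close>.\<close>

lemma ulam_iff_factors:
  assumes "length w > 1"
  shows "ulam w \<longleftrightarrow> (\<exists>!(u, v). u \<noteq> v \<and> u @ v = w \<and> ulam u \<and> ulam v)"
proof -
  have bound: "(\<exists>i\<in>{1..<length w}. u \<in> ulam_words i) \<and> (\<exists>j\<in>{1..<length w}. v \<in> ulam_words j)
      \<longleftrightarrow> ulam u \<and> ulam v" if "u @ v = w" for u v
  proof
    assume "ulam u \<and> ulam v"
    then have "u \<in> ulam_words (length u)" "v \<in> ulam_words (length v)" "length u > 0" "length v > 0"
      using not_ulam_Nil by (auto simp: ulam_iff_length)
    moreover have "length u + length v = length w" using that by auto
    ultimately show "(\<exists>i\<in>{1..<length w}. u \<in> ulam_words i) \<and> (\<exists>j\<in>{1..<length w}. v \<in> ulam_words j)"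
      by (intro conjI bexI[of _ "length u"] bexI[of _ "length v"]) (simp_all only: atLeastLessThan_iff, linarith+)
  qed (auto simp: ulam_def)
  have "w \<in> ulam_words (length w) \<longleftrightarrow> (\<exists>!(u, v). u \<noteq> v \<and> u @ v = w \<and>
      (\<exists>i\<in>{1..<length w}. u \<in> ulam_words i) \<and> (\<exists>j\<in>{1..<length w}. v \<in> ulam_words j))"
    using assms
    by (subst ulam_words.simps, subst if_not_P, linarith, subst if_not_P, linarith)
      (simp only: mem_Collect_eq simp_thms)
  also have "\<dots> \<longleftrightarrow> (\<exists>!(u, v). u \<noteq> v \<and> u @ v = w \<and> ulam u \<and> ulam v)"
    by (simp only: bound cong: conj_cong)
  finally show ?thesis by (simp only: ulam_iff_length[of w])
qed

text \<open>For \<open>n > 1\<close>, Ulam factors of a word of zeros have length 1 by induction and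
  hence coincide, whereas distinct factors are demanded.\<close>

lemma ulam_replicate_False: "ulam (replicate n False) \<longleftrightarrow> n = 1"
proof (induction n rule: less_induct)
  case (less n)
  consider "n = 0" | "n = 1" | "n > 1" by linarith
  then show ?case
  proof cases
    case 3
    have "u = v" if uv: "u @ v = replicate n False" "ulam u" "ulam v" for u v
    proof -
      have len: "length u + length v = n" using uv(1) by (metis length_append length_replicate)
      have "set (u @ v) \<subseteq> {False}" using uv(1) by (simp add: set_replicate_conv_if)
      then have "u = replicate (length u) False" "v = replicate (length v) False"
        by (auto intro!: replicate_eqI)
      moreover have "length u > 0" "length v > 0" using uv not_ulam_Nil by auto
      ultimately have "length u = 1 \<and> length v = 1"
        using less[of "length u"] less[of "length v"] len uv
        by (metis less_add_same_cancel1 less_add_same_cancel2)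
      with \<open>u = replicate _ _\<close> \<open>v = replicate _ _\<close> show ?thesis by simp
    qed
    then show ?thesis using 3 by (subst ulam_iff_factors) auto
  qed (use not_ulam_Nil ulam_singleton in auto)
qed

text \<open>Only one factor holds the letter 1; the other consists of zeros and is the single letter
  0 by \<open>ulam_replicate_False\<close>.\<close>

lemma one_word_factors:
  assumes "ulam u" "ulam v"
  shows "u @ v = one_word x a \<longleftrightarrow>
    (\<exists>x'. x = Suc x' \<and> u = [False] \<and> v = one_word x' a) \<or>
    (\<exists>a'. a = Suc a' \<and> u = one_word x a' \<and> v = [False])" (is "_ \<longleftrightarrow> ?R")
proof
  assume *: "u @ v = one_word x a"
  then have "count_list (u @ v) True = 1" using count_True_1_iff by blast
  then consider "count_list u True = 0" | "count_list u True = 1" "count_list v True = 0"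
    by (simp, linarith)
  then show ?R
  proof cases
    case 1
    then have "u = [False]"
      using assms(1) ulam_replicate_False by (metis One_nat_def count_True_0_iff replicate_0 replicate_Suc)
    with * show ?thesis by (simp add: Cons_False_eq_one_word)
  next
    case 2
    then have v: "v = replicate 1 False"
      using assms(2) ulam_replicate_False by (metis count_True_0_iff)
    obtain p q where "u = one_word p q" using 2 count_True_1_iff by blast
    with * have "one_word p (q + 1) = one_word x a"
      unfolding v by (simp only: one_word_append_replicate)
    with v \<open>u = _\<close> show ?thesis by (auto simp: one_word_inject)
  qed
next
  assume ?R
  then show "u @ v = one_word x a"
    using one_word_append_replicate[of x _ 1] by (auto simp: Cons_False_eq_one_word)
qed

lemma one_word_neq_False: "one_word x a \<noteq> [False]"
  by (cases x) (auto simp: one_word_def)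

text \<open>The two candidate factorizations split off a 0 in front or at the end and differ as
  pairs. Hence uniqueness is an exclusive or, written as \<open>\<noteq>\<close> between truth
  values.\<close>

lemma ulam_one_word_rec:
  assumes "x + a > 0"
  shows "ulam (one_word x a) \<longleftrightarrow>
    (\<exists>x'. x = Suc x' \<and> ulam (one_word x' a)) \<noteq> (\<exists>a'. a = Suc a' \<and> ulam (one_word x a'))"
proof -
  have fac: "u \<noteq> v \<and> u @ v = one_word x a \<and> ulam u \<and> ulam v \<longleftrightarrow>
    (\<exists>x'. x = Suc x' \<and> u = [False] \<and> v = one_word x' a \<and> ulam v) \<or>
    (\<exists>a'. a = Suc a' \<and> u = one_word x a' \<and> v = [False] \<and> ulam u)" for u v
    using one_word_factors[of u v x a] one_word_neq_False ulam_singleton by metis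
  \<comment> \<open>For \<open>x = 0\<close> or \<open>a = 0\<close> truncated subtraction yields a
    meaningless pair, but its existential guard is then false.\<close>
  let ?p = "([False], one_word (x - 1) a)" and ?q = "(one_word x (a - 1), [False])"
  have "length (one_word x a) > 1" using assms by (auto simp: one_word_def)
  then have "ulam (one_word x a) \<longleftrightarrow> (\<exists>!(u, v).
    (\<exists>x'. x = Suc x' \<and> u = [False] \<and> v = one_word x' a \<and> ulam v) \<or>
    (\<exists>a'. a = Suc a' \<and> u = one_word x a' \<and> v = [False] \<and> ulam u))"
    by (simp only: ulam_iff_factors fac)
  also have "\<dots> \<longleftrightarrow> (\<exists>!p. p = ?p \<and> (\<exists>x'. x = Suc x' \<and> ulam (one_word x' a)) \<or>
      p = ?q \<and> (\<exists>a'. a = Suc a' \<and> ulam (one_word x a')))"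
    by (intro arg_cong[of _ _ Ex1] ext) (auto split: prod.split)
  also have "\<dots> \<longleftrightarrow>
    (\<exists>x'. x = Suc x' \<and> ulam (one_word x' a)) \<noteq> (\<exists>a'. a = Suc a' \<and> ulam (one_word x a'))"
  proof -
    have "(\<exists>!r. r = p \<and> A \<or> r = q \<and> B) \<longleftrightarrow> A \<noteq> B" if "p \<noteq> q" for A B and p q :: "bool list \<times> bool list"
      using that by metis
    moreover have "?p \<noteq> ?q" using one_word_neq_False by (metis prod.inject)
    ultimately show ?thesis by blast
  qed
  finally show ?thesis .
qed

text \<open>Pascal's rule modulo 2, as the binomial coefficient of \<open>x + a\<close> over
  \<open>x\<close> is odd iff \<open>and x a = 0\<close>. Comparing lowest bits suffices unless
  \<open>x\<close> and \<open>a\<close> are both odd; then the claim reduces to their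
  halves.\<close>

lemma and_Suc_Suc_eq_0:
  fixes x a :: nat
  shows "and (Suc x) (Suc a) = 0 \<longleftrightarrow> (and x (Suc a) = 0) \<noteq> (and (Suc x) a = 0)"
proof (induction "x + a" arbitrary: x a rule: less_induct)
  case less
  have bits: "and (2 * m) (2 * n) = 0 \<longleftrightarrow> and m n = 0" "and (2 * m) (2 * n + 1) = 0 \<longleftrightarrow> and m n = 0"
    "and (2 * m + 1) (2 * n) = 0 \<longleftrightarrow> and m n = 0" "and (2 * m + 1) (2 * n + 1) \<noteq> 0" for m n :: nat
    by (subst and_rec; simp)+
  have Suc: "Suc (2 * m) = 2 * m + 1" "Suc (2 * m + 1) = 2 * Suc m" for m by auto
  obtain p q where "x = 2 * p \<or> x = 2 * p + 1" "a = 2 * q \<or> a = 2 * q + 1"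
    by (metis oddE evenE)
  then show ?case
    using less[of p q] by (elim disjE) (simp_all only: Suc bits, auto)
qed

lemma ulam_one_word_iff: "ulam (one_word x a) \<longleftrightarrow> and x a = 0"
proof (induction "x + a" arbitrary: x a rule: less_induct)
  case less
  show ?case
  proof (cases "x + a = 0")
    case True
    then show ?thesis using ulam_singleton by (simp add: one_word_def)
  next
    case False
    then have "ulam (one_word x a) \<longleftrightarrow>
        (\<exists>x'. x = Suc x' \<and> and x' a = 0) \<noteq> (\<exists>a'. a = Suc a' \<and> and x a' = 0)"
      using less by (subst ulam_one_word_rec) auto
    with False show ?thesis by (cases x; cases a) (auto simp: and_Suc_Suc_eq_0)
  qed
qed

section \<open>Counting carry-constrained splittings\<close>

definition splits :: "nat \<Rightarrow> nat \<Rightarrow> nat \<Rightarrow> (nat \<times> nat) set" where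
  "splits y x z = {(a, b). a + b = y \<and> and x a = 0 \<and> and b z = 0}"

text \<open>For \<open>y < 2 ^ m\<close> membership in the block is automatic. It matters for larger
  \<open>y\<close>, where the sum of two \<open>m\<close>-bit parts has to produce a carry.\<close>

definition bsplits :: "nat \<Rightarrow> nat \<Rightarrow> nat \<Rightarrow> nat \<Rightarrow> (nat \<times> nat) set" where
  "bsplits m y x z = splits y x z \<inter> block m"

definition cnt :: "nat \<Rightarrow> nat \<Rightarrow> nat \<Rightarrow> nat \<Rightarrow> nat" where
  "cnt m y x z = card (bsplits m y x z)"

lemma finite_bsplits [simp]: "finite (bsplits m y x z)"
  by (simp add: bsplits_def block_def)

lemma splits_eq_bsplits: "y < 2 ^ m \<Longrightarrow> splits y x z = bsplits m y x z"
  by (auto simp: splits_def bsplits_def block_def)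

lemma c_ulam_eq_card: "c_ulam y (x, z) = min 2 (card (splits y x z))"
proof -
  have "{(u, v). ulam u \<and> ulam v \<and> count_list u True = 1 \<and> count_list v True = 1 \<and>
      u @ v = replicate x False @ [True] @ replicate y False @ [True] @ replicate z False}
     = (\<lambda>(a, b). (one_word x a, one_word b z)) ` splits y x z" (is "?L = ?R")
  proof (intro subset_antisym subsetI)
    fix p assume "p \<in> ?L"
    then obtain u v where p: "p = (u, v)" and uv: "ulam u" "ulam v" "count_list u True = 1"
        "count_list v True = 1"
        "u @ v = replicate x False @ [True] @ replicate y False @ [True] @ replicate z False"
      by blast
    obtain x' a b z' where ow: "u = one_word x' a" "v = one_word b z'"
      using uv(3,4) count_True_1_iff by metis
    have "replicate x' False @ True # replicate (a + b) False @ True # replicate z' False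
      = replicate x False @ True # replicate y False @ True # replicate z False"
      using uv(5) ow by (simp add: one_word_def replicate_add)
    then have "x' = x" "a + b = y" "z' = z" by (auto simp: replicate_True_eq_iff)
    with ow uv show "p \<in> ?R" by (auto simp: p splits_def ulam_one_word_iff)
  next
    fix p assume "p \<in> ?R"
    then obtain a b where p: "p = (one_word x a, one_word b z)" "(a, b) \<in> splits y x z" by auto
    moreover from p(2) have "one_word x a @ one_word b z
       = replicate x False @ [True] @ replicate y False @ [True] @ replicate z False"
      by (auto simp: splits_def one_word_def replicate_add)
    ultimately show "p \<in> ?L" using count_True_1_iff by (auto simp: splits_def ulam_one_word_iff)
  qed
  moreover have "inj_on (\<lambda>(a, b). (one_word x a, one_word b z)) (splits y x z)"
    by (auto simp: inj_on_def one_word_inject)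
  ultimately show ?thesis by (simp add: c_ulam_def card_image)
qed

lemma c_ulam_eq_cnt: "y < 2 ^ m \<Longrightarrow> c_ulam y (x, z) = min 2 (cnt m y x z)"
  by (simp add: c_ulam_eq_card cnt_def splits_eq_bsplits)

lemma and_eq_0_split:
  fixes a x :: nat
  shows "and a x = 0 \<longleftrightarrow>
    and (a mod 2 ^ d) (x mod 2 ^ d) = 0 \<and> and (a div 2 ^ d) (x div 2 ^ d) = 0"
proof -
  have "and a x = 0 \<longleftrightarrow> take_bit d (and a x) = 0 \<and> drop_bit d (and a x) = 0"
    by (metis bits_ident add_0 push_bit_of_0 take_bit_of_0 drop_bit_of_0)
  then show ?thesis by (simp flip: take_bit_eq_mod drop_bit_eq_div)
qed

lemma pow_mult_add_mod_div:
  fixes a b :: nat shows "a < 2 ^ d \<Longrightarrow> (2 ^ d * b + a) mod 2 ^ d = a"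
    "a < 2 ^ d \<Longrightarrow> (2 ^ d * b + a) div 2 ^ d = b"
  by auto

text \<open>The two summands correspond to the absence and presence of a carry out of the low \<open>d\<close> bits.\<close>

lemma cnt_add:
  assumes "r < 2 ^ d"
  shows "cnt (d + m) (2 ^ d * Suc q + r) x z =
    cnt d r (x mod 2 ^ d) (z mod 2 ^ d) * cnt m (Suc q) (x div 2 ^ d) (z div 2 ^ d) +
    cnt d (2 ^ d + r) (x mod 2 ^ d) (z mod 2 ^ d) * cnt m q (x div 2 ^ d) (z div 2 ^ d)"
proof -
  let ?lo = "\<lambda>y. bsplits d y (x mod 2 ^ d) (z mod 2 ^ d)"
  let ?hi = "\<lambda>y. bsplits m y (x div 2 ^ d) (z div 2 ^ d)"
  let ?f = "\<lambda>((a, b), (a', b')). (2 ^ d * a' + a, 2 ^ d * b' + b)"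
  let ?S = "?lo r \<times> ?hi (Suc q) \<union> ?lo (2 ^ d + r) \<times> ?hi q"
  have inj: "inj_on ?f ?S"
  proof (rule inj_on_inverseI)
    fix s assume "s \<in> ?S"
    then show "(\<lambda>(a, b). ((a mod 2 ^ d, b mod 2 ^ d), (a div 2 ^ d, b div 2 ^ d))) (?f s) = s"
      by (auto simp: bsplits_def block_def pow_mult_add_mod_div)
  qed
  have lt: "2 ^ d * a' + a < 2 ^ (d + m)" if "a' < 2 ^ m" "a < 2 ^ d" for a a' :: nat
  proof -
    have "2 ^ d * a' + a < 2 ^ d * Suc a'" using that by simp
    also have "\<dots> \<le> 2 ^ d * 2 ^ m" using that by (intro mult_left_mono) auto
    finally show ?thesis by (simp add: power_add)
  qed
  have "bsplits (d + m) (2 ^ d * Suc q + r) x z = ?f ` ?S"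
  proof (intro subset_antisym subsetI)
    fix p assume "p \<in> bsplits (d + m) (2 ^ d * Suc q + r) x z"
    then obtain a b where p: "p = (a, b)" and ab: "a + b = 2 ^ d * Suc q + r"
        "and x a = 0" "and b z = 0" "a < 2 ^ (d + m)" "b < 2 ^ (d + m)"
      by (auto simp: bsplits_def splits_def block_def)
    define a0 a1 b0 b1 where d: "a0 = a mod 2 ^ d" "a1 = a div 2 ^ d"
      "b0 = b mod 2 ^ d" "b1 = b div 2 ^ d"
    have a: "a = 2 ^ d * a1 + a0" "a0 < 2 ^ d" and b: "b = 2 ^ d * b1 + b0" "b0 < 2 ^ d"
      by (auto simp: d)
    have hi: "a1 < 2 ^ m" "b1 < 2 ^ m"
      using ab by (auto simp: d less_mult_imp_div_less power_add mult.commute)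
    have e: "2 ^ d * (a1 + b1) + (a0 + b0) = 2 ^ d * Suc q + r"
      using ab(1) a b by (simp add: algebra_simps)
    \<comment> \<open>Two residues below \<open>2 ^ d\<close> carry at most 1; once the carry is
      moved, uniqueness of division with remainder fixes both sums.\<close>
    have "(a0 + b0 = r \<and> a1 + b1 = Suc q) \<or> (a0 + b0 = 2 ^ d + r \<and> a1 + b1 = q)"
    proof (cases "a0 + b0 < 2 ^ d")
      case True
      then show ?thesis using e assms pow_mult_add_mod_div by metis
    next
      case False
      then have "2 ^ d * Suc (a1 + b1) + (a0 + b0 - 2 ^ d) = 2 ^ d * Suc q + r"
        using e by simp
      moreover have "a0 + b0 - 2 ^ d < 2 ^ d" using a b by linarith
      ultimately have "a0 + b0 - 2 ^ d = r \<and> Suc (a1 + b1) = Suc q"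
        using assms pow_mult_add_mod_div by metis
      with False show ?thesis by auto
    qed
    moreover have "and (x mod 2 ^ d) a0 = 0" "and (x div 2 ^ d) a1 = 0"
      "and b0 (z mod 2 ^ d) = 0" "and b1 (z div 2 ^ d) = 0"
      using ab(2,3) and_eq_0_split unfolding d by blast+
    ultimately have "((a0, b0), (a1, b1)) \<in> ?S"
      using a(2) b(2) hi by (auto simp: bsplits_def splits_def block_def)
    then show "p \<in> ?f ` ?S"
      by (intro image_eqI[of _ _ "((a0, b0), (a1, b1))"]) (auto simp: p a(1) b(1))
  next
    fix p assume "p \<in> ?f ` ?S"
    then obtain a b a' b' where p: "p = (2 ^ d * a' + a, 2 ^ d * b' + b)"
      and s: "((a, b), (a', b')) \<in> ?S" by (elim imageE) (metis (mono_tags, lifting) case_prod_conv prod.collapse)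
    then have b: "a < 2 ^ d" "b < 2 ^ d" "a' < 2 ^ m" "b' < 2 ^ m"
      and n: "and (x mod 2 ^ d) a = 0" "and (x div 2 ^ d) a' = 0"
      "and b (z mod 2 ^ d) = 0" "and b' (z div 2 ^ d) = 0"
      and e: "(a + b = r \<and> a' + b' = Suc q) \<or> (a + b = 2 ^ d + r \<and> a' + b' = q)"
      by (auto simp: bsplits_def splits_def block_def)
    have "and x (2 ^ d * a' + a) = 0" "and (2 ^ d * b' + b) z = 0"
      using n by (subst and_eq_0_split[of _ _ d]; simp only: pow_mult_add_mod_div b)+
    moreover have "2 ^ d * a' + a + (2 ^ d * b' + b) = 2 ^ d * (a' + b') + (a + b)"
      by (simp add: algebra_simps)
    then have "2 ^ d * a' + a + (2 ^ d * b' + b) = 2 ^ d * Suc q + r"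
      using e by auto
    ultimately show "p \<in> bsplits (d + m) (2 ^ d * Suc q + r) x z"
      using b lt by (simp add: p bsplits_def splits_def block_def)
  qed
  then have "cnt (d + m) (2 ^ d * Suc q + r) x z = card ?S"
    using inj by (simp add: cnt_def card_image)
  also have "\<dots> = card (?lo r \<times> ?hi (Suc q)) + card (?lo (2 ^ d + r) \<times> ?hi q)"
    by (intro card_Un_disjoint finite_cartesian_product finite_bsplits) (auto simp: bsplits_def splits_def)
  finally show ?thesis by (simp add: cnt_def card_cartesian_product)
qed

section \<open>Counts for small targets, and splitting off the top bit\<close>

lemma cnt_0 [simp]: "cnt m 0 x z = 1"
proof -
  have "bsplits m 0 x z = {(0, 0)}" by (auto simp: bsplits_def splits_def block_def)
  then show ?thesis by (simp add: cnt_def)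
qed

lemma and_1_eq_0: "and (1::nat) z = 0 \<longleftrightarrow> even z" "and x (1::nat) = 0 \<longleftrightarrow> even x"
  by (auto simp: and_one_eq one_and_eq odd_iff_mod_2_eq_one even_iff_mod_2_eq_zero)

lemma one_less_pow_2: "m > 0 \<Longrightarrow> (1::nat) < 2 ^ m"
  by (intro one_less_power) auto

lemma cnt_1: "m > 0 \<Longrightarrow> cnt m 1 x z = (if even x then 1 else 0) + (if even z then 1 else 0)"
proof -
  assume "m > 0"
  then have "(1::nat) < 2 ^ m" by (rule one_less_pow_2)
  then have "bsplits m 1 x z = (if even x then {(1, 0)} else {}) \<union> (if even z then {(0, 1)} else {})"
    by (auto simp: bsplits_def splits_def block_def add_is_1 and_1_eq_0[unfolded One_nat_def]
        split: if_splits)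
  then show ?thesis by (simp add: cnt_def)
qed

lemma cnt_1_2: "cnt 1 2 x z = (if even x \<and> even z then 1 else 0)"
proof -
  have "bsplits 1 2 x z = (if even x \<and> even z then {(1, 1)} else {})"
    by (auto simp: bsplits_def splits_def block_def and_1_eq_0 less_2_cases_iff
        and_1_eq_0[unfolded One_nat_def])
  then show ?thesis by (simp add: cnt_def)
qed

text \<open>Two numbers below \<open>2 ^ d\<close> add up to at most \<open>2 * 2 ^ d - 2\<close>,
  whence the \<open>Suc\<close>.\<close>

lemma cnt_eq_0: "2 * 2 ^ d \<le> Suc y \<Longrightarrow> cnt d y x z = 0"
proof -
  assume "2 * 2 ^ d \<le> Suc y"
  then have "bsplits d y x z = {}" by (auto simp: bsplits_def splits_def block_def)
  then show ?thesis by (simp add: cnt_def)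
qed

lemma even_div_pow_iff: "x < 2 ^ Suc d \<Longrightarrow> even (x div 2 ^ d) \<longleftrightarrow> x < 2 ^ d" for x :: nat
proof -
  assume "x < 2 ^ Suc d"
  then have "x div 2 ^ d < 2" by (simp add: less_mult_imp_div_less)
  then have "even (x div 2 ^ d) \<longleftrightarrow> x div 2 ^ d = 0" by (auto simp: less_2_cases_iff)
  then show ?thesis by (simp add: div_eq_0_iff)
qed

lemma mod_pow_Suc: "x < 2 ^ Suc d \<Longrightarrow> x mod 2 ^ d = (if x < 2 ^ d then x else x - 2 ^ d)" for x :: nat
  by (simp add: mod_if[of x])

lemma even_mod_pow: "d > 0 \<Longrightarrow> even (x mod 2 ^ d) \<longleftrightarrow> even x" for x :: nat
  by (simp add: dvd_mod_iff)

text \<open>\<open>cnt_add\<close> with a high part of one bit and the target written as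
  \<open>2 ^ d * 2 + r\<close>. Without a carry both top bits of the parts are 1, with a carry
  exactly one is. This drives the inductions on \<open>d\<close> below.\<close>

lemma cnt_Suc_top:
  assumes "r < 2 ^ d" "x < 2 ^ Suc d" "z < 2 ^ Suc d"
  shows "cnt (Suc d) (2 ^ Suc d + r) x z =
    (if x < 2 ^ d \<and> z < 2 ^ d then cnt d r x z else 0) +
    cnt d (2 ^ d + r) (x mod 2 ^ d) (z mod 2 ^ d) *
      ((if x < 2 ^ d then 1 else 0) + (if z < 2 ^ d then 1 else 0))"
proof -
  have "cnt (Suc d) (2 ^ Suc d + r) x z = cnt (d + 1) (2 ^ d * Suc 1 + r) x z" by (simp add: mult_2)
  also have "\<dots> = cnt d r (x mod 2 ^ d) (z mod 2 ^ d) * cnt 1 2 (x div 2 ^ d) (z div 2 ^ d) +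
      cnt d (2 ^ d + r) (x mod 2 ^ d) (z mod 2 ^ d) * cnt 1 1 (x div 2 ^ d) (z div 2 ^ d)"
    using cnt_add[OF assms(1), of 1 1 x z] by (simp only: Suc_1)
  finally show ?thesis
    using assms(2,3) cnt_1[OF zero_less_one] by (simp add: cnt_1_2[unfolded One_nat_def] even_div_pow_iff)
qed

section \<open>Positivity of the counts with a leading bit\<close>

text \<open>The largest admissible parts are the complements \<open>2 ^ d - 1 - x\<close> and
  \<open>2 ^ d - 1 - z\<close>, whose sum must reach \<open>2 ^ d\<close>. The induction strips top
  bits: two zeros give a splitting at once, two ones leave none, one of each reduces to
  \<open>d\<close>.\<close>

lemma cnt_pow_pos_iff:
  assumes "x < 2 ^ d" "z < 2 ^ d"
  shows "cnt d (2 ^ d) x z > 0 \<longleftrightarrow> x + z + 1 < 2 ^ d"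
  using assms
proof (induction d arbitrary: x z)
  case (Suc d)
  then show ?case
    using cnt_Suc_top[of 0 d x z] Suc.IH[of "x mod 2 ^ d" "z mod 2 ^ d"]
    by (auto simp: mod_pow_Suc)
qed (simp add: cnt_eq_0)

text \<open>Compared with \<open>cnt_pow_pos_iff\<close> the target is one larger, which sharpens
  the bound, and odd, so that one part is odd and forces \<open>x\<close> or \<open>z\<close> to be
  even.\<close>

lemma cnt_pow_Suc_pos_iff:
  assumes "d > 0" "x < 2 ^ d" "z < 2 ^ d"
  shows "cnt d (2 ^ d + 1) x z > 0 \<longleftrightarrow> x + z + 2 < 2 ^ d \<and> (even x \<or> even z)"
  using assms
proof (induction d arbitrary: x z rule: nat_induct_non_zero)
  case 1
  then show ?case by (simp add: cnt_eq_0)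
next
  case (Suc d)
  have rec: "cnt (Suc d) (2 ^ Suc d + 1) x z =
    (if x < 2 ^ d \<and> z < 2 ^ d then (if even x then 1 else 0) + (if even z then 1 else 0) else 0) +
    cnt d (2 ^ d + 1) (x mod 2 ^ d) (z mod 2 ^ d) *
      ((if x < 2 ^ d then 1 else 0) + (if z < 2 ^ d then 1 else 0))"
    using cnt_Suc_top[OF one_less_pow_2[OF Suc.hyps(1)] Suc.prems] Suc.hyps(1) by (simp only: cnt_1)
  have IH: "cnt d (2 ^ d + 1) (x mod 2 ^ d) (z mod 2 ^ d) > 0 \<longleftrightarrow>
      x mod 2 ^ d + z mod 2 ^ d + 2 < 2 ^ d \<and> (even x \<or> even z)"
    using Suc.IH[of "x mod 2 ^ d" "z mod 2 ^ d"] Suc.hyps by (simp add: even_mod_pow)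
  show ?case
  proof (cases "x < 2 ^ d \<and> z < 2 ^ d")
    case True
    \<comment> \<open>With both numbers below \<open>2 ^ d\<close>, the bound fails only at
      \<open>x = z = 2 ^ d - 1\<close>, which is odd.\<close>
    have "x + z + 2 < 2 ^ Suc d" if "even x \<or> even z"
    proof -
      have "even (2 ^ d :: nat)" using Suc.hyps by simp
      then have "x + 1 \<noteq> 2 ^ d \<or> z + 1 \<noteq> 2 ^ d" using that by (metis even_plus_one_iff)
      then show ?thesis using True by auto
    qed
    then show ?thesis using True rec IH by auto
  next
    case False
    then show ?thesis using rec IH Suc.prems by (auto simp: mod_pow_Suc)
  qed
qed

text \<open>Either part can be the odd one. In the induction, two zero top bits already contribute
  \<open>cnt d 1 x z = 2\<close>.\<close>

lemma cnt_pow_Suc_ge_2: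
  assumes "d > 0" "x < 2 ^ d" "z < 2 ^ d" "even x" "even z" "x + z + 2 < 2 ^ d"
  shows "cnt d (2 ^ d + 1) x z \<ge> 2"
  using assms
proof (induction d arbitrary: x z rule: nat_induct_non_zero)
  case (Suc d)
  then show ?case
    using cnt_Suc_top[of 1 d x z] one_less_pow_2[of d] cnt_1[of d x z]
      Suc.IH[of "x mod 2 ^ d" "z mod 2 ^ d"]
    by (auto simp: mod_pow_Suc)
qed simp

section \<open>The basic labelings as counts\<close>

text \<open>\<open>x mod 2 ^ (e + 1) < 2 ^ e\<close> says that bit \<open>e\<close> of
  \<open>x\<close> is 0, so these are the common zero positions of \<open>x\<close> and
  \<open>z\<close> below \<open>d\<close>.\<close>

definition gaps :: "nat \<Rightarrow> nat \<Rightarrow> nat \<Rightarrow> nat set" where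
  "gaps d x z = {e. e < d \<and> x mod 2 ^ (e + 1) < 2 ^ e \<and> z mod 2 ^ (e + 1) < 2 ^ e}"

lemma top_gap_eq_Max: "top_gap d x z = Max (gaps d x z)"
  by (simp add: top_gap_def gaps_def)

lemma finite_gaps [simp]: "finite (gaps d x z)"
  by (simp add: gaps_def)

lemma top_gap_Suc_low: "x < 2 ^ d \<Longrightarrow> z < 2 ^ d \<Longrightarrow> top_gap (Suc d) x z = d"
  unfolding top_gap_eq_Max by (rule Max_eqI) (auto simp: gaps_def)

lemma gaps_Suc_high:
  assumes "x < 2 ^ Suc d" "z < 2 ^ Suc d" "\<not> (x < 2 ^ d \<and> z < 2 ^ d)"
  shows "gaps (Suc d) x z = gaps d (x mod 2 ^ d) (z mod 2 ^ d)"
proof -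
  have "x mod 2 ^ d mod 2 ^ (e + 1) = x mod 2 ^ (e + 1)" if "e < d" for e and x :: nat
    using that by (intro mod_mod_cancel le_imp_power_dvd) auto
  then show ?thesis
    using assms by (auto simp: gaps_def less_Suc_eq)
qed

text \<open>Without a common zero bit, \<open>x\<close> and \<open>z\<close> together cover all
  \<open>d\<close> positions and \<open>x + z \<ge> 2 ^ d - 1\<close>. Nonemptiness makes the
  \<open>Max\<close> in \<open>top_gap\<close> meaningful.\<close>

lemma gaps_nonempty:
  assumes "x < 2 ^ d" "z < 2 ^ d" "x + z + 1 < 2 ^ d"
  shows "gaps d x z \<noteq> {}"
  using assms
proof (induction d arbitrary: x z)
  case (Suc d)
  show ?case
  proof (cases "x < 2 ^ d \<and> z < 2 ^ d")
    case True
    then have "d \<in> gaps (Suc d) x z" by (simp add: gaps_def)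
    then show ?thesis by blast
  next
    case False
    then have "x mod 2 ^ d + z mod 2 ^ d + 1 < 2 ^ d"
      using Suc.prems by (auto simp: mod_pow_Suc)
    then show ?thesis using gaps_Suc_high[of x d z] Suc False by simp
  qed
qed simp

lemma gap_label_Suc_high:
  assumes "x < 2 ^ Suc d" "z < 2 ^ Suc d" "\<not> (x < 2 ^ d \<and> z < 2 ^ d)"
    and "x + z + 1 < 2 ^ Suc d"
  shows "gap_label (Suc d) x z = gap_label d (x mod 2 ^ d) (z mod 2 ^ d)"
proof -
  have "x mod 2 ^ d + z mod 2 ^ d + 1 < 2 ^ d"
    using assms by (auto simp: mod_pow_Suc)
  then have "gaps d (x mod 2 ^ d) (z mod 2 ^ d) \<noteq> {}" by (intro gaps_nonempty) auto
  then have "top_gap d (x mod 2 ^ d) (z mod 2 ^ d) \<in> gaps d (x mod 2 ^ d) (z mod 2 ^ d)"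
    unfolding top_gap_eq_Max by (intro Max_in finite_gaps)
  \<comment> \<open>As the top gap lies below \<open>d\<close>, reducing modulo \<open>2 ^ d\<close>
    first does not change the residues in \<open>gap_label\<close>.\<close>
  then have "top_gap d (x mod 2 ^ d) (z mod 2 ^ d) < d" by (simp add: gaps_def)
  then have "x mod 2 ^ d mod 2 ^ e = x mod 2 ^ e" "z mod 2 ^ d mod 2 ^ e = z mod 2 ^ e"
    if "e = top_gap d (x mod 2 ^ d) (z mod 2 ^ d)" for e
    using that by (auto intro!: mod_mod_cancel le_imp_power_dvd)
  then show ?thesis
    using gaps_Suc_high[OF assms(1-3)] by (simp add: gap_label_def top_gap_eq_Max)
qed

text \<open>Top bits are stripped until both are 0. There the count is
  \<open>1 + 2 * cnt d (2 ^ d + r) x z\<close>, so the cap is reached iff the carry count is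
  positive. While exactly one top bit is 1, count and label both stay the same. For
  \<open>r = 1\<close> the parity hypothesis ensures \<open>cnt d 1 x z = 1\<close>.\<close>

lemma min_2_cnt_eq_gap_label:
  assumes "r = 0 \<or> r = 1 \<and> odd (x + z)"
    and "x < 2 ^ d" "z < 2 ^ d" "x + z + 1 + r < 2 ^ d"
  shows "min 2 (cnt d (2 ^ d + r) x z) = gap_label d x z"
  using assms
proof (induction d arbitrary: x z)
  case (Suc d)
  have d: "d > 0" if "r = 1" using Suc.prems that by (cases d) auto
  then have r: "r < 2 ^ d" using Suc.prems one_less_pow_2[of d] by auto
  let ?x = "x mod 2 ^ d" and ?z = "z mod 2 ^ d"
  show ?case
  proof (cases "x < 2 ^ d \<and> z < 2 ^ d")
    case True
    have w: "cnt d r x z = 1"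
      using Suc.prems(1) d by (auto simp: cnt_1[unfolded One_nat_def])
    have "cnt d (2 ^ d + r) x z > 0 \<longleftrightarrow> x + z < 2 ^ d - 1"
    proof (cases "r = 0")
      case True
      then show ?thesis using \<open>x < 2 ^ d \<and> z < 2 ^ d\<close> cnt_pow_pos_iff[of x d z] by auto
    next
      case False
      then have "r = 1" "odd (x + z)" using Suc.prems(1) by auto
      moreover have "even (2 ^ d :: nat)" using \<open>r = 1\<close> d by simp
      \<comment> \<open>The bounds for \<open>r = 0\<close> and \<open>r = 1\<close> differ only at
        this value, which parity excludes.\<close>
      then have "x + z + 2 \<noteq> 2 ^ d"
        using \<open>odd (x + z)\<close> by (metis even_add even_numeral)
      ultimately show ?thesis
        using \<open>x < 2 ^ d \<and> z < 2 ^ d\<close> cnt_pow_Suc_pos_iff[of d x z] d by auto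
    qed
    then show ?thesis
      using True cnt_Suc_top[OF r Suc.prems(2,3)] w top_gap_Suc_low[of x d z]
      by (auto simp: gap_label_def Let_def)
  next
    case False
    have par: "odd (?x + ?z)" if "r = 1" using d Suc.prems(1) that by (auto simp: even_mod_pow)
    have le: "?x + ?z + 1 + r < 2 ^ d" and one: "x < 2 ^ d \<or> z < 2 ^ d"
      using False Suc.prems by (auto simp: mod_pow_Suc)
    have "cnt (Suc d) (2 ^ Suc d + r) x z = cnt d (2 ^ d + r) ?x ?z"
      using False one cnt_Suc_top[OF r Suc.prems(2,3)] by auto
    moreover have "gap_label (Suc d) x z = gap_label d ?x ?z"
      using False Suc.prems by (intro gap_label_Suc_high) auto
    ultimately show ?thesis using Suc.IH[of ?x ?z] le par Suc.prems(1) by auto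
  qed
qed simp

lemma E1_eq_cnt:
  assumes "x < 2 ^ d" "z < 2 ^ d"
  shows "E1 d (x, z) = min 2 (cnt d (2 ^ d) x z)"
proof (cases "x + z + 1 < 2 ^ d")
  case True
  then show ?thesis using min_2_cnt_eq_gap_label[of 0 x z d] assms by (auto simp: E1_def)
next
  case False
  then show ?thesis using cnt_pow_pos_iff[OF assms] by (auto simp: E1_def)
qed

lemma O1_eq_cnt:
  assumes "d > 0" "x < 2 ^ d" "z < 2 ^ d"
  shows "O1 d (x, z) = min 2 (cnt d (2 ^ d + 1) x z)"
proof (cases "x + z + 2 < 2 ^ d")
  case lt: True
  show ?thesis
  proof (cases "even (x + z)")
    case True
    then show ?thesis
      using lt cnt_pow_Suc_pos_iff[OF assms] cnt_pow_Suc_ge_2[OF assms]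
      by (cases "even x") (auto simp: O1_def min_def)
  next
    case False
    then show ?thesis using lt min_2_cnt_eq_gap_label[of 1 x z d] assms by (auto simp: O1_def)
  qed
next
  case False
  then show ?thesis using cnt_pow_Suc_pos_iff[OF assms] by (auto simp: O1_def)
qed

lemma O2_eq_cnt: "d > 0 \<Longrightarrow> O2 d (x, z) = cnt d 1 x z"
  by (auto simp: O2_def cnt_1[unfolded One_nat_def])

text \<open>Together with \<open>tmul_min_2\<close>: capping at 2 is a semiring homomorphism onto
  the labels, so identities between counts become identities between labels.\<close>

lemma tadd_min_2: "min 2 a \<boxplus> min 2 b = min 2 (a + b)"
  by (simp add: tadd_def)

lemma tmul_min_2: "min 2 a \<boxdot> min 2 b = min 2 (a * b)"
proof -
  consider "a = 0" | "b = 0" | "a = 1" | "b = 1" | "a \<ge> 2" "b \<ge> 2" by linarith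
  then show ?thesis
  proof cases
    case 5
    then have "2 * 2 \<le> a * b" by (intro mult_mono) auto
    with 5 show ?thesis by (simp add: tmul_def min_def)
  qed (auto simp: tmul_def min_def)
qed

lemma c_ulam_in_labels: "c_ulam y p \<in> labels"
  by (cases p) (auto simp: c_ulam_eq_card labels_def min_def)

section \<open>Internal hierarchical structure\<close>

lemma c_ulam_internal_step:
  assumes "r < 2 ^ d"
  shows "c_ulam (2 ^ d * Suc q + r) (x, z) =
    c_ulam q (x div 2 ^ d, z div 2 ^ d) \<boxdot> min 2 (cnt d (2 ^ d + r) (x mod 2 ^ d) (z mod 2 ^ d)) \<boxplus>
    c_ulam (Suc q) (x div 2 ^ d, z div 2 ^ d) \<boxdot> min 2 (cnt d r (x mod 2 ^ d) (z mod 2 ^ d))"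
proof -
  \<comment> \<open>The width \<open>Suc q\<close> of the high part is chosen large enough for
    \<open>q\<close> and \<open>Suc q\<close>, and \<open>d + Suc q\<close> for the whole target, so
    confinement to blocks loses no splitting.\<close>
  have "Suc q < 2 ^ Suc q" by (rule less_exp)
  moreover have "2 ^ d * Suc q + r < 2 ^ (d + (Suc q))"
  proof -
    have "2 ^ d * Suc q + r < 2 ^ d * Suc (Suc q)" using assms by simp
    also have "\<dots> \<le> 2 ^ d * 2 ^ Suc q" using \<open>Suc q < _\<close> by (intro mult_left_mono Suc_leI) auto
    finally show ?thesis by (simp add: power_add)
  qed
  ultimately show ?thesis
    using cnt_add[OF assms, of "Suc q" q x z]
    by (simp add: c_ulam_eq_cnt[of _ "d + Suc q"] c_ulam_eq_cnt[of _ "Suc q"] tadd_min_2 tmul_min_2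
        ac_simps)
qed

text \<open>For \<open>j > 1\<close>, what remains of the target once the blocks below
  \<open>j\<close> are cut off is this number after a carry, and its successor without one.\<close>

definition tail_sum :: "nat \<Rightarrow> (nat \<Rightarrow> nat) \<Rightarrow> nat \<Rightarrow> nat" where
  "tail_sum s d j = (\<Sum>i=j..s. 2 ^ (\<Sum>k=j..i. d k))"

lemma tail_sum_rec:
  assumes "j \<le> s"
  shows "tail_sum s d j = 2 ^ d j * Suc (tail_sum s d (Suc j))"
proof -
  have "(\<Sum>k=j..i. d k) = d j + (\<Sum>k=Suc j..i. d k)" if "i \<ge> j" for i
    using that by (rule sum.atLeast_Suc_atMost)
  then have "(\<Sum>i=Suc j..s. 2 ^ (\<Sum>k=j..i. d k)) = (2 ^ d j * tail_sum s d (Suc j) :: nat)"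
    unfolding tail_sum_def sum_distrib_left by (intro sum.cong) (auto simp: power_add)
  then show ?thesis
    unfolding tail_sum_def using assms by (simp add: sum.atLeast_Suc_atMost[of j s] tail_sum_def)
qed

lemma internal_hierarchical_c_ulam:
  assumes d: "\<forall>i\<in>{1..s}. d i \<ge> 1"
    and y: "y = tail_sum s d 1 \<or> y = Suc (tail_sum s d 1)"
  shows "internal_hierarchical s d (restrict (c_ulam y) (block ((\<Sum>k=1..s. d k) + 1)))"
proof -
  \<comment> \<open>The witnesses belong to the two targets that can remain at level
    \<open>j\<close>; at \<open>j = s + 1\<close> these are 0 and 1.\<close>
  let ?ce = "\<lambda>j. c_ulam (tail_sum s d j)" and ?co = "\<lambda>j. c_ulam (Suc (tail_sum s d j))"
  have step: "?ce j (x, z) = I_even (d j) (?ce (j + 1) (x div 2 ^ d j, z div 2 ^ d j))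
        (?co (j + 1) (x div 2 ^ d j, z div 2 ^ d j)) (x mod 2 ^ d j, z mod 2 ^ d j)"
      "?co j (x, z) = I_odd (d j) (?ce (j + 1) (x div 2 ^ d j, z div 2 ^ d j))
        (?co (j + 1) (x div 2 ^ d j, z div 2 ^ d j)) (x mod 2 ^ d j, z mod 2 ^ d j)"
    if "j \<in> {1..s}" for j x z
  proof -
    have pos: "d j > 0" "j \<le> s" using bspec[OF d that] that by auto
    then have "min 2 (cnt (d j) 1 x z) = cnt (d j) 1 x z" "1 < (2::nat) ^ d j" for x z
      by (simp_all only: cnt_1 one_less_pow_2) auto
    then show "?co j (x, z) = I_odd (d j) (?ce (j + 1) (x div 2 ^ d j, z div 2 ^ d j))
        (?co (j + 1) (x div 2 ^ d j, z div 2 ^ d j)) (x mod 2 ^ d j, z mod 2 ^ d j)"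
      using c_ulam_internal_step[of 1 "d j" "tail_sum s d (Suc j)" x z] pos
      by (simp add: I_odd_def O1_eq_cnt O2_eq_cnt tail_sum_rec)
    show "?ce j (x, z) = I_even (d j) (?ce (j + 1) (x div 2 ^ d j, z div 2 ^ d j))
        (?co (j + 1) (x div 2 ^ d j, z div 2 ^ d j)) (x mod 2 ^ d j, z mod 2 ^ d j)"
      using c_ulam_internal_step[of 0 "d j" "tail_sum s d (Suc j)" x z] pos
      by (simp add: I_even_def E1_eq_cnt E2_def tail_sum_rec)
  qed
  show ?thesis
    unfolding internal_hierarchical_def Let_def
    using y step by (intro conjI exI[of _ ?ce] exI[of _ ?co]) (auto simp: c_ulam_in_labels)
qed

section \<open>External hierarchical structure\<close>

definition offx :: "nat \<Rightarrow> nat" where "offx i = (if i = 1 \<or> i = 3 then 1 else 0)"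

definition offz :: "nat \<Rightarrow> nat" where "offz i = (if i = 2 \<or> i = 3 then 1 else 0)"

text \<open>The number of splittings of the leading bit of \<open>y\<close> that quadrant \<open>i\<close> admits.\<close>

definition wt :: "nat \<Rightarrow> nat" where
  "wt i = (if i = 0 then 2 else if i = 1 \<or> i = 2 then 1 else 0)"

text \<open>The high target is the leading bit 1. Without a carry it is split between the two top
  bits in \<open>wt i\<close> ways; with a carry 0 remains, which splits in one way.\<close>

lemma cnt_quadrant:
  assumes "r < 2 ^ D" "x < 2 ^ D" "z < 2 ^ D" "i < 4"
  shows "cnt (Suc D) (2 ^ D + r) (2 ^ D * offx i + x) (2 ^ D * offz i + z) =
    wt i * cnt D r x z + cnt D (2 ^ D + r) x z"
proof -
  have "i \<in> {0, 1, 2, 3}" using assms(4) by auto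
  then have "cnt 1 1 (offx i) (offz i) = wt i"
    unfolding cnt_1[OF zero_less_one] by (auto simp: wt_def offx_def offz_def)
  then show ?thesis
    using cnt_add[OF assms(1), of 1 0 "2 ^ D * offx i + x" "2 ^ D * offz i + z"] assms(2,3)
    by (simp add: pow_mult_add_mod_div)
qed

lemma L_even_eq_cnt:
  assumes "x < 2 ^ d" "z < 2 ^ d"
  shows "L_even d i (x, z) = min 2 (wt i + cnt d (2 ^ d) x z)"
  using assms by (simp add: L_even_def E2_def E1_eq_cnt tadd_def tmul_def wt_def min_def)

lemma cnt_1_pos:
  "d > 0 \<Longrightarrow> cnt d (2 ^ d + 1) x z > 0 \<Longrightarrow> x < 2 ^ d \<Longrightarrow> z < 2 ^ d \<Longrightarrow> cnt d 1 x z > 0"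
  by (simp only: cnt_pow_Suc_pos_iff cnt_1) auto

text \<open>For \<open>i = 0\<close> the labeling omits \<open>O1\<close>. By
  \<open>cnt_1_pos\<close> nothing is lost: \<open>O1\<close> vanishes where \<open>O2\<close> does,
  and elsewhere doubling \<open>O2\<close> reaches the cap.\<close>

lemma L_odd_eq_cnt:
  assumes "d > 0" "x < 2 ^ d" "z < 2 ^ d"
  shows "L_odd d i (x, z) = min 2 (wt i * cnt d 1 x z + cnt d (2 ^ d + 1) x z)"
  using cnt_1_pos[OF assms(1) _ assms(2,3)] O2_eq_cnt[OF assms(1), of x z] O1_eq_cnt[OF assms]
  by (cases "cnt d 1 x z = 0") (auto simp: L_odd_def tadd_def tmul_def wt_def min_def)

text \<open>Without the two hypotheses, \<open>I_index\<close> would lose information: if its second argument is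
  positive, it forgets the first one, which matters only for \<open>p = 0 < q\<close>.\<close>

lemma I_index_eq:
  fixes e o' p q :: nat
  assumes "o' > 0 \<longrightarrow> e > 0" "q > 0 \<longrightarrow> p > 0"
  defines "k \<equiv> I_index (min 2 e) (min 2 o')"
  shows "min 2 (p * o' + q * e) =
    (if k = 4 then 0 else if k = 5 then (if min 2 q = 0 then 0 else 2) else min 2 (wt k * p + q))"
proof -
  have ge2: "2 \<le> a * b" if "a \<ge> 2" "b > 0" for a b :: nat
    using mult_le_mono[of 2 a 1 b] that by simp
  show ?thesis
  proof (cases "p = 0")
    case True
    then have "q = 0" using assms(2) by simp
    with True show ?thesis by simp
  next
    case p: False
    consider "o' = 0" | "o' = 1" | "o' \<ge> 2" by linarith
    then show ?thesis
    proof cases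
      case 1
      \<comment> \<open>Only \<open>q * e\<close> is left; the three cases lead to the indices 4, 3
        and 5.\<close>
      consider "e = 0" | "e = 1" | "e \<ge> 2" by linarith
      then show ?thesis
        using 1 ge2[of e q] by cases (auto intro!: gr0I simp: k_def I_index_def wt_def min_def mult.commute)
    next
      case 2
      \<comment> \<open>Index 2 replaces \<open>q * e\<close> by \<open>q\<close>. If
        \<open>q > 0\<close>, then \<open>p + q\<close> reaches the cap anyway.\<close>
      then have "q \<le> q * e" using assms(1) by simp
      then have "q > 0 \<Longrightarrow> 2 \<le> p + q \<and> 2 \<le> p + q * e" using p by linarith
      then have "min 2 (p + q * e) = min 2 (p + q)" by (cases "q = 0") simp_all
      with 2 show ?thesis by (simp add: k_def I_index_def wt_def)
    next
      case 3
      then show ?thesis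
        using p ge2[of o' p] by (simp add: k_def I_index_def wt_def min_def mult.commute)
    qed
  qed
qed

definition psum :: "(nat \<Rightarrow> nat) \<Rightarrow> nat \<Rightarrow> nat" where
  "psum d j = (\<Sum>k=1..j. d k)"

text \<open>The values 0 and 1 of \<open>c\<close> give the two forms of the target; dropping the
  blocks above \<open>j\<close> leaves this number.\<close>

definition head_sum :: "(nat \<Rightarrow> nat) \<Rightarrow> nat \<Rightarrow> nat \<Rightarrow> nat" where
  "head_sum d c j = c + (\<Sum>i=1..j. 2 ^ psum d i)"

lemma psum_Suc [simp]: "psum d (Suc j) = psum d j + d (Suc j)"
  by (simp add: psum_def)

lemma head_sum_Suc [simp]: "head_sum d c (Suc j) = 2 ^ psum d (Suc j) + head_sum d c j"
  by (simp add: head_sum_def)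

lemma head_sum_0 [simp]: "head_sum d c 0 = c"
  by (simp add: head_sum_def)

lemma head_sum_less:
  assumes "\<And>i. i \<in> {1..Suc j} \<Longrightarrow> d i > 0" "c \<le> 1"
  shows "head_sum d c j < 2 ^ psum d (Suc j)"
  using assms
proof (induction j)
  case 0
  then show ?case using one_less_pow_2[of "d 1"] by (simp add: psum_def)
next
  case (Suc j)
  have "head_sum d c (Suc j) < 2 ^ psum d (Suc j) * 2" using Suc by simp
  also have "\<dots> = 2 ^ (psum d (Suc j) + 1)" by simp
  also have "\<dots> \<le> 2 ^ psum d (Suc (Suc j))"
    using Suc.prems(1)[of "Suc (Suc j)"] by (intro power_increasing) auto
  finally show ?case .
qed

text \<open>Supplies the second hypothesis of \<open>I_index_eq\<close>. A cut below the block
  \<open>Suc j\<close> expands both counts with the same \<open>?P\<close> and \<open>?Q\<close>.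
  Since 0 always splits, \<open>?Q > 0\<close> suffices; otherwise \<open>cnt_1_pos\<close> settles
  the high factor of \<open>?P\<close>.\<close>

lemma cnt_head_sum_pos:
  assumes "\<And>i. i \<in> {1..Suc j} \<Longrightarrow> d i > 0" "c \<le> 1"
    and "x < 2 ^ psum d (Suc j)" "z < 2 ^ psum d (Suc j)"
    and "cnt (psum d (Suc j)) (2 ^ psum d (Suc j) + head_sum d c j) x z > 0"
  shows "cnt (psum d (Suc j)) (head_sum d c j) x z > 0"
proof (cases j)
  case 0
  have "c = 0 \<or> c = 1" using assms(2) by auto
  moreover have "d 1 > 0" using assms(1)[of 1] by auto
  ultimately show ?thesis
    using assms cnt_1_pos[of "d 1" x z] 0 by (auto simp: psum_def)
next
  case (Suc j')
  let ?D = "psum d (Suc j')" and ?d = "d (Suc j)" and ?r = "head_sum d c j'"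
  let ?P = "cnt ?D ?r (x mod 2 ^ ?D) (z mod 2 ^ ?D)"
    and ?Q = "cnt ?D (2 ^ ?D + ?r) (x mod 2 ^ ?D) (z mod 2 ^ ?D)"
  have D: "psum d (Suc j) = ?D + ?d" by (simp add: Suc)
  have r: "?r < 2 ^ ?D" using assms(1,2) Suc by (intro head_sum_less) auto
  have hi: "x div 2 ^ ?D < 2 ^ ?d" "z div 2 ^ ?D < 2 ^ ?d"
    using assms(3,4) unfolding D by (auto intro!: less_mult_imp_div_less simp: power_add mult.commute)
  have "2 ^ psum d (Suc j) + head_sum d c j = 2 ^ ?D * Suc (2 ^ ?d) + ?r"
    unfolding D by (simp add: Suc power_add algebra_simps)
  then have "?P * cnt ?d (2 ^ ?d + 1) (x div 2 ^ ?D) (z div 2 ^ ?D) +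
      ?Q * cnt ?d (2 ^ ?d) (x div 2 ^ ?D) (z div 2 ^ ?D) > 0"
    using assms(5) cnt_add[OF r, of ?d "2 ^ ?d" x z] unfolding D by simp
  moreover have "head_sum d c j = 2 ^ ?D * Suc 0 + ?r"
    by (simp add: Suc)
  then have "cnt (psum d (Suc j)) (head_sum d c j) x z =
      ?P * cnt ?d 1 (x div 2 ^ ?D) (z div 2 ^ ?D) + ?Q"
    using cnt_add[OF r, of ?d 0 x z] unfolding D by simp
  ultimately show ?thesis
    using cnt_1_pos[OF assms(1)[of "Suc j"] _ hi] by auto
qed

lemma div_mod_quadrant:
  fixes x :: nat
  shows "(2 ^ (m + n) * b + x) mod 2 ^ m = x mod 2 ^ m"
    and "(2 ^ (m + n) * b + x) div 2 ^ m = 2 ^ n * b + x div 2 ^ m"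
proof -
  have e: "2 ^ (m + n) * b + x = x + 2 ^ m * (2 ^ n * b)" by (simp add: power_add)
  show "(2 ^ (m + n) * b + x) mod 2 ^ m = x mod 2 ^ m" unfolding e by simp
  show "(2 ^ (m + n) * b + x) div 2 ^ m = 2 ^ n * b + x div 2 ^ m" unfolding e by simp
qed

definition quadrant :: "nat \<Rightarrow> nat \<Rightarrow> nat \<Rightarrow> nat \<times> nat \<Rightarrow> nat" where
  "quadrant y D i = (\<lambda>(x, z). c_ulam y (2 ^ D * offx i + x, 2 ^ D * offz i + z))"

definition quadrant_ext :: "nat \<Rightarrow> nat \<Rightarrow> nat \<Rightarrow> nat \<times> nat \<Rightarrow> nat" where
  "quadrant_ext y D i p =
    (if i = 4 then 0 else if i = 5 then (if quadrant y D 3 p = 0 then 0 else 2)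
     else quadrant y D i p)"

lemma quadrant_eq_cnt:
  assumes "r < 2 ^ D" "x < 2 ^ D" "z < 2 ^ D" "i < 4"
  shows "quadrant (2 ^ D + r) D i (x, z) = min 2 (wt i * cnt D r x z + cnt D (2 ^ D + r) x z)"
proof -
  have "2 ^ D + r < 2 ^ Suc D" using assms by simp
  then show ?thesis
    unfolding quadrant_def using cnt_quadrant[OF assms] by (simp add: c_ulam_eq_cnt del: power_Suc)
qed

text \<open>Cutting below the highest block gives \<open>?P * ?o + ?Q * ?e\<close>, where the high
  counts \<open>?o\<close> and \<open>?e\<close> matter only through the index that
  \<open>I_index\<close> assigns to their labels.\<close>

lemma quadrant_external_step:
  assumes d: "\<And>i. i \<in> {1..Suc (Suc j)} \<Longrightarrow> d i > 0" and c: "c \<le> 1" and i: "i < 4"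
    and x: "x < 2 ^ psum d (Suc (Suc j))" and z: "z < 2 ^ psum d (Suc (Suc j))"
  defines "D \<equiv> psum d (Suc j)" and "m \<equiv> d (Suc (Suc j))"
  shows "quadrant (head_sum d c (Suc (Suc j))) (psum d (Suc (Suc j))) i (x, z) =
    quadrant_ext (head_sum d c (Suc j)) D
      (I_index (L_even m i (x div 2 ^ D, z div 2 ^ D)) (L_odd m i (x div 2 ^ D, z div 2 ^ D)))
      (x mod 2 ^ D, z mod 2 ^ D)"
proof -
  let ?r = "head_sum d c j"
  let ?xl = "x mod 2 ^ D" and ?zl = "z mod 2 ^ D" and ?xh = "x div 2 ^ D" and ?zh = "z div 2 ^ D"
  let ?P = "cnt D ?r ?xl ?zl" and ?Q = "cnt D (2 ^ D + ?r) ?xl ?zl"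
  let ?e = "wt i + cnt m (2 ^ m) ?xh ?zh"
    and ?o = "wt i * cnt m 1 ?xh ?zh + cnt m (2 ^ m + 1) ?xh ?zh"
  have Dm: "psum d (Suc (Suc j)) = D + m" by (simp add: D_def m_def)
  have m: "m > 0" unfolding m_def by (rule d) simp
  have r: "?r < 2 ^ D" unfolding D_def using d c by (intro head_sum_less) auto
  have hi: "?xh < 2 ^ m" "?zh < 2 ^ m"
    using x z unfolding Dm by (auto intro!: less_mult_imp_div_less simp: power_add mult.commute)
  have lo: "?xl < 2 ^ D" "?zl < 2 ^ D" by auto
  \<comment> \<open>The high target is \<open>2 ^ m + 1\<close> without a carry and
    \<open>2 ^ m\<close> with one, hence the odd and the even labelings.\<close>
  have y: "head_sum d c (Suc (Suc j)) = 2 ^ D * Suc (2 ^ m) + ?r"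
    by (simp add: D_def m_def power_add algebra_simps)
  have y': "head_sum d c (Suc j) = 2 ^ D + ?r" by (simp add: D_def)
  \<comment> \<open>The \<open>Suc m\<close> high bits are the block of \<open>m\<close> bits and
    the quadrant bit above it.\<close>
  have "2 ^ D * Suc (2 ^ m) + ?r < 2 ^ (D + Suc m)"
  proof -
    have "2 ^ D * Suc (2 ^ m) + ?r < 2 ^ D * (2 ^ m + 2)" using r by (simp add: algebra_simps)
    also have "\<dots> \<le> 2 ^ D * 2 ^ Suc m"
      using one_less_pow_2[OF m] by (intro mult_left_mono) auto
    finally show ?thesis by (simp add: power_add)
  qed
  then have "quadrant (head_sum d c (Suc (Suc j))) (psum d (Suc (Suc j))) i (x, z) =
      min 2 (cnt (D + Suc m) (2 ^ D * Suc (2 ^ m) + ?r)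
        (2 ^ (D + m) * offx i + x) (2 ^ (D + m) * offz i + z))"
    unfolding quadrant_def y Dm by (simp only: c_ulam_eq_cnt case_prod_conv)
  also have "\<dots> = min 2 (?P * cnt (Suc m) (2 ^ m + 1) (2 ^ m * offx i + ?xh) (2 ^ m * offz i + ?zh) +
      ?Q * cnt (Suc m) (2 ^ m + 0) (2 ^ m * offx i + ?xh) (2 ^ m * offz i + ?zh))"
    unfolding cnt_add[OF r] div_mod_quadrant by simp
  also have "\<dots> = min 2 (?P * ?o + ?Q * ?e)"
    using cnt_quadrant[OF one_less_pow_2[OF m] hi i] cnt_quadrant[OF _ hi i, of 0] by simp
  also have "\<dots> = quadrant_ext (head_sum d c (Suc j)) D (I_index (min 2 ?e) (min 2 ?o)) (?xl, ?zl)"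
  proof -
    \<comment> \<open>If \<open>wt i = 0\<close>, only the counts with a leading bit remain, and the
      bound for \<open>2 ^ m + 1\<close> implies the one for \<open>2 ^ m\<close>.\<close>
    have Fe: "?o > 0 \<longrightarrow> ?e > 0"
      using cnt_pow_Suc_pos_iff[OF m hi] cnt_pow_pos_iff[OF hi] by auto
    have Q: "?Q > 0 \<longrightarrow> ?P > 0"
      using cnt_head_sum_pos[of j d c ?xl ?zl] d c lo unfolding D_def by auto
    define k where "k = I_index (min 2 ?e) (min 2 ?o)"
    have quad: "quadrant (head_sum d c (Suc j)) D l (?xl, ?zl) = min 2 (wt l * ?P + ?Q)" if "l < 4" for l
      unfolding y' using that by (rule quadrant_eq_cnt[OF r lo])
    have "k = 4 \<or> k = 5 \<or> k < 4" by (auto simp: k_def I_index_def)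
    \<comment> \<open>Weight 0 makes quadrant 3 record \<open>?Q\<close> alone, from which index 5
      is derived.\<close>
    moreover have "quadrant (head_sum d c (Suc j)) D 3 (?xl, ?zl) = min 2 ?Q"
      using quad[of 3] by (simp add: wt_def)
    ultimately have "quadrant_ext (head_sum d c (Suc j)) D k (?xl, ?zl) =
        (if k = 4 then 0 else if k = 5 then (if min 2 ?Q = 0 then 0 else 2) else min 2 (wt k * ?P + ?Q))"
      unfolding quadrant_ext_def by (elim disjE) (simp_all add: quad del: head_sum_Suc)
    then show ?thesis using I_index_eq[OF Fe Q] unfolding k_def by (simp only:)
  qed
  finally show ?thesis
    by (simp add: L_even_eq_cnt[OF hi] L_odd_eq_cnt[OF m hi])
qed

lemma quadrant_ext_in_labels: "quadrant_ext y D i p \<in> labels"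
  by (cases p) (auto simp: quadrant_ext_def quadrant_def c_ulam_in_labels, auto simp: labels_def)

lemma external_hierarchical_c_ulam:
  assumes d: "\<forall>i\<in>{1..s}. d i \<ge> 1" and c: "c \<le> 1"
  shows "external_hierarchical s d
    (restrict (c_ulam (head_sum d c s)) (block ((\<Sum>k=1..s. d k) + 1)))"
proof -
  \<comment> \<open>Level \<open>j\<close> uses the target truncated to the first \<open>j\<close>
    blocks, whose leading bit is at \<open>psum d j\<close>.\<close>
  let ?c = "\<lambda>j. quadrant_ext (head_sum d c j) (psum d j)"
  have step: "?c j i (x, z) = ?c (j - 1)
      (I_index (L_even (d j) i (x div 2 ^ psum d (j - 1), z div 2 ^ psum d (j - 1)))
        (L_odd (d j) i (x div 2 ^ psum d (j - 1), z div 2 ^ psum d (j - 1))))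
      (x mod 2 ^ psum d (j - 1), z mod 2 ^ psum d (j - 1))"
    if "j \<in> {2..s}" "i < 4" "(x, z) \<in> block (psum d j)" for j i x z
  proof -
    define j' where "j' = j - 2"
    have j: "j = Suc (Suc j')" and j1: "j - 1 = Suc j'" using that(1) by (auto simp: j'_def)
    have pos: "d l > 0" if "l \<in> {1..Suc (Suc j')}" for l
      using bspec[OF d, of l] that \<open>j \<in> {2..s}\<close> j by auto
    have "?c j i (x, z) = quadrant (head_sum d c j) (psum d j) i (x, z)"
      using that(2) by (simp add: quadrant_ext_def)
    then show ?thesis
      unfolding j1 unfolding j
      using quadrant_external_step[where j = j' and d = d and x = x and z = z, OF pos c that(2)] that(3) by (simp add: block_def j)
  qed
  \<comment> \<open>All four quadrants lie inside the block with one more bit, where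
    \<open>restrict\<close> changes nothing.\<close>
  have restr: "restrict (c_ulam (head_sum d c s)) (block (psum d s + 1))
      (2 ^ psum d s * offx i + x, 2 ^ psum d s * offz i + z) = ?c s i (x, z)"
    if "(x, z) \<in> block (psum d s)" "i < 4" for x z i
    using that by (auto simp: block_def quadrant_ext_def quadrant_def offx_def offz_def)
  show ?thesis
    unfolding external_hierarchical_def Let_def psum_def[symmetric]
  proof (intro conjI exI[of _ ?c] ballI allI impI case_prodI2)
    show "restrict (c_ulam (head_sum d c s)) (block (psum d s + 1)) \<in> block (psum d s + 1) \<rightarrow> labels"
      by (auto simp: c_ulam_in_labels)
    show "?c j i \<in> block (psum d j) \<rightarrow> labels" for j i by (simp add: quadrant_ext_in_labels)
    show "?c j 4 p = empty_label" for j p by (simp add: quadrant_ext_def empty_label_def)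
    show "?c j 5 p = (if ?c j 3 p = empty_label then empty_label else full_label)" for j p
      by (simp add: quadrant_ext_def empty_label_def full_label_def)
  next
    fix p x z assume p: "p \<in> block (psum d s)" "p = (x, z)"
    note R = restr[of x z 0] restr[of x z 1] restr[of x z 2] restr[of x z 3]
    show "?c s 0 (x, z) = restrict (c_ulam (head_sum d c s)) (block (psum d s + 1)) (x, z)"
      "?c s 1 (x, z) = restrict (c_ulam (head_sum d c s)) (block (psum d s + 1)) (2 ^ psum d s + x, z)"
      "?c s 2 (x, z) = restrict (c_ulam (head_sum d c s)) (block (psum d s + 1)) (x, 2 ^ psum d s + z)"
      "?c s 3 (x, z) = restrict (c_ulam (head_sum d c s)) (block (psum d s + 1))
         (2 ^ psum d s + x, 2 ^ psum d s + z)"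
      using R p by (simp_all add: offx_def offz_def)
  qed (use step in auto)
qed

theorem theorem1p15:
  fixes s y :: nat and d :: "nat \<Rightarrow> nat"
  assumes "s \<ge> 1"
    and "\<forall>i\<in>{1..s}. d i \<ge> 1"
    and "y = (\<Sum>i=1..s. 2 ^ (\<Sum>k=1..i. d k)) \<or> y = 1 + (\<Sum>i=1..s. 2 ^ (\<Sum>k=1..i. d k))"
  shows "internal_hierarchical s d (restrict (c_ulam y) (block ((\<Sum>k=1..s. d k) + 1))) \<and>
         external_hierarchical s d (restrict (c_ulam y) (block ((\<Sum>k=1..s. d k) + 1)))"
proof
  show "internal_hierarchical s d (restrict (c_ulam y) (block ((\<Sum>k=1..s. d k) + 1)))"
    using assms by (intro internal_hierarchical_c_ulam) (auto simp: tail_sum_def)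
  have "y = head_sum d 0 s \<or> y = head_sum d 1 s"
    using assms(3) by (simp add: head_sum_def psum_def)
  then show "external_hierarchical s d (restrict (c_ulam y) (block ((\<Sum>k=1..s. d k) + 1)))"
    using external_hierarchical_c_ulam[OF assms(2)] by auto
qed

end
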